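(* Let $\mathcal{M}_{int}$ be an intensional model with type set $\mathcal{T}$ and domains $\{\mathcal{D}_\tau\}_{\tau\in\mathcal{T}}$. Then there exist a family of vector spaces $\{\mathcal{S}_{\mathcal{D}_\tau}\}_{\tau\in\mathcal{T}}$ over $\mathbb{R}$ and injective maps $h_\tau:\mathcal{D}_\tau\to\mathcal{S}_{\mathcal{D}_\tau}$, one for each $\tau\in\mathcal{T}$, such that for every $n\ge 1$, all types $\tau_1,\dots,\tau_{n+1}\in\mathcal{T}$ and every semantic function $$f:\mathcal{D}_{\tau_1}\times\mathcal{D}_{\tau_2}\times\cdots\times\mathcal{D}_{\tau_n}\longrightarrow\mathcal{D}_{\tau_{n+1}},$$ there is a corresponding (multi)linear map $$f':\operatorname{im}(h_{\tau_1})\times\operatorname{im}(h_{\tau_2})\times\cdots\times\operatorname{im}(h_{\tau_n})\longrightarrow\operatorname{im}(h_{\tau_{n+1}})$$ satisfying, for all $a_i\in\mathcal{D}_{\tau_i}$, $$h_{\tau_{n+1}}(f(a_1,a_2,\dots,a_n))=f'(h_{\tau_1}(a_1),h_{\tau_2}(a_2),\dots,h_{\tau_n}(a_n)).$$ Moreover, composition of functions in $\mathcal{M}_{int}$ corresponds to composition of their lifts: for any composable semantic functions $f_i:\mathcal{D}_{\tau_i}\to\mathcal{D}_{\tau_{i+1}}$ ($1\le i\le n$), one has $(f_n\circ\cdots\circ f_1)'=f_n'\circ\cdots\circ f_1'$ on $\operatorname{im}(h_{\tau_1})$.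
   Context: Let $\Sigma$ be a non-empty set of index sorts (e.g. worlds, times, locations). The set $\mathcal{T}$ of intensional types is the smallest set such that $e\in\mathcal{T}$ (entities), $t\in\mathcal{T}$ (truth values), $\sigma\in\mathcal{T}$ for each $\sigma\in\Sigma$, and $\langle\alpha,\beta\rangle\in\mathcal{T}$ whenever $\alpha,\beta\in\mathcal{T}$. An intensional model is a tuple $\mathcal{M}_{int}=\langle(\mathcal{D}_\tau)_{\tau\in\mathcal{T}},(\mathcal{F}_\sigma)_{\sigma\in\Sigma},S,\mathcal{I}\rangle$, where $\mathcal{D}_e$ is a non-empty set; $\mathcal{D}_t=\{0,1\}$; $\mathcal{D}_\sigma$ is a non-empty set for each $\sigma\in\Sigma$; $\mathcal{D}_{\langle\alpha,\beta\rangle}=\mathcal{D}_\beta^{\mathcal{D}_\alpha}$ is the set of all functions $\mathcal{D}_\alpha\to\mathcal{D}_\beta$; $\mathcal{F}_\sigma=(\mathcal{D}_\sigma,\mathcal{R}_\sigma)$ is a frame with accessibility relation $\mathcal{R}_\sigma\subseteq\mathcal{D}_\sigma\times\mathcal{D}_\sigma$; $S=\prod_{\sigma\in\Sigma}\mathcal{D}_\sigma$ is the set of compound indices; and $\mathcal{I}$ assigns to each non-logical constant $c$ of type $\tau$ of a formal language an intension $\mathcal{I}(c):S\to\mathcal{D}_\tau$. A semantic function is any function from a finite product of domains $\mathcal{D}_{\tau_1}\times\cdots\times\mathcal{D}_{\tau_n}$ to a domain $\mathcal{D}_{\tau_{n+1}}$. The lift of $f$ is the map $f'$ in the claim. Since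 the images $\operatorname{im}(h_\tau)$ are subsets and need not be linear subspaces, "$f'$ is (multi)linear" means that $f'$ extends to a multilinear map $\operatorname{span}(\operatorname{im}(h_{\tau_1}))\times\cdots\times\operatorname{span}(\operatorname{im}(h_{\tau_n}))\to\mathcal{S}_{\mathcal{D}_{\tau_{n+1}}}$ (linear when $n=1$). *)

theory Defs
  imports "HOL-Analysis.Analysis" "HOL-Analysis.Finite_Function_Topology"
begin

text \<open>The set of index sorts is the type \<open>'s\<close>, which is non-empty like every HOL type.\<close>

datatype 's itype = Entity | Truth | Index 's | Fn "'s itype" "'s itype"

definition compound_indices :: "('s itype \<Rightarrow> 'u set) \<Rightarrow> ('s \<Rightarrow> 'u) set" where
  "compound_indices D = (\<Pi>\<^sub>E \<sigma>\<in>UNIV. D (Index \<sigma>))"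

text \<open>
  HOL has no single type containing the function spaces of all finite orders over a given set, so
  the domains are subsets of an arbitrary universe \<open>'u\<close> whose elements code truth values
  and functions: \<open>tv\<close> codes the two truth values and \<open>ap \<alpha> \<beta> d\<close> is the function coded by
  \<open>d \<in> D (Fn \<alpha> \<beta>)\<close>. By \<open>dom_Fn\<close> every function from \<open>D \<alpha>\<close> to \<open>D \<beta>\<close> has exactly one code.
  The typing \<open>ty\<close> of the non-logical constants \<open>'c\<close> belongs to the formal language.
\<close>

locale intensional_model =
  fixes D :: "'s itype \<Rightarrow> 'u set"
    and tv :: "bool \<Rightarrow> 'u"
    and ap :: "'s itype \<Rightarrow> 's itype \<Rightarrow> 'u \<Rightarrow> 'u \<Rightarrow> 'u"
    and R :: "'s \<Rightarrow> ('u \<times> 'u) set"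
    and S :: "('s \<Rightarrow> 'u) set"
    and ty :: "'c \<Rightarrow> 's itype"
    and I :: "'c \<Rightarrow> ('s \<Rightarrow> 'u) \<Rightarrow> 'u"
  assumes dom_Entity: "D Entity \<noteq> {}"
    and dom_Truth: "bij_betw tv UNIV (D Truth)"
    and dom_Index: "D (Index \<sigma>) \<noteq> {}"
    and dom_Fn: "bij_betw (\<lambda>d. restrict (ap \<alpha> \<beta> d) (D \<alpha>)) (D (Fn \<alpha> \<beta>)) (D \<alpha> \<rightarrow>\<^sub>E D \<beta>)"
    and frame: "R \<sigma> \<subseteq> D (Index \<sigma>) \<times> D (Index \<sigma>)"
    and indices: "S = compound_indices D"
    and intension: "I c \<in> S \<rightarrow> D (ty c)"

text \<open>An element of a product of \<open>n\<close> sets is an extensional function on \<open>{1..n}\<close>.\<close>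

definition semantic_function ::
    "('s itype \<Rightarrow> 'u set) \<Rightarrow> nat \<Rightarrow> (nat \<Rightarrow> 's itype) \<Rightarrow> ((nat \<Rightarrow> 'u) \<Rightarrow> 'u) \<Rightarrow> bool" where
  "semantic_function D n \<tau> f \<longleftrightarrow> f \<in> (\<Pi>\<^sub>E i\<in>{1..n}. D (\<tau> i)) \<rightarrow> D (\<tau> (n + 1))"

definition multilinear_on ::
    "nat \<Rightarrow> (nat \<Rightarrow> 'v::real_vector set) \<Rightarrow> 'w::real_vector set \<Rightarrow> ((nat \<Rightarrow> 'v) \<Rightarrow> 'w) \<Rightarrow> bool" where
  "multilinear_on n V W F \<longleftrightarrow>
     F \<in> (\<Pi>\<^sub>E i\<in>{1..n}. V i) \<rightarrow> W \<and>
     (\<forall>x \<in> \<Pi>\<^sub>E i\<in>{1..n}. V i. \<forall>i\<in>{1..n}. \<forall>u\<in>V i. \<forall>v\<in>V i. \<forall>c::real.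
        F (x(i := u + v)) = F (x(i := u)) + F (x(i := v)) \<and>
        F (x(i := c *\<^sub>R u)) = c *\<^sub>R F (x(i := u)))"

text \<open>
  \<open>V\<close> is the family of vector spaces and \<open>h\<close> the family of maps into them; \<open>f'\<close> is a lift of the
  \<open>n\<close>-ary semantic function \<open>f\<close>. As the images of the \<open>h\<close> need not be subspaces,
  multilinearity of \<open>f'\<close> means that it extends to a multilinear map on their spans.
\<close>

definition is_lift ::
    "('s itype \<Rightarrow> 'u set) \<Rightarrow> ('s itype \<Rightarrow> 'v::real_vector set) \<Rightarrow> ('s itype \<Rightarrow> 'u \<Rightarrow> 'v) \<Rightarrow>
     nat \<Rightarrow> (nat \<Rightarrow> 's itype) \<Rightarrow> ((nat \<Rightarrow> 'u) \<Rightarrow> 'u) \<Rightarrow> ((nat \<Rightarrow> 'v) \<Rightarrow> 'v) \<Rightarrow> bool" where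
  "is_lift D V h n \<tau> f f' \<longleftrightarrow>
     f' \<in> (\<Pi>\<^sub>E i\<in>{1..n}. h (\<tau> i) ` D (\<tau> i)) \<rightarrow> h (\<tau> (n + 1)) ` D (\<tau> (n + 1)) \<and>
     (\<exists>F. multilinear_on n (\<lambda>i. span (h (\<tau> i) ` D (\<tau> i))) (V (\<tau> (n + 1))) F \<and>
          (\<forall>x \<in> \<Pi>\<^sub>E i\<in>{1..n}. h (\<tau> i) ` D (\<tau> i). F x = f' x)) \<and>
     (\<forall>a \<in> \<Pi>\<^sub>E i\<in>{1..n}. D (\<tau> i).
        h (\<tau> (n + 1)) (f a) = f' (\<lambda>i\<in>{1..n}. h (\<tau> i) (a i)))"

text \<open>The case of one argument, with 1-tuples identified with their only component.\<close>

definition is_lift1 ::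
    "('s itype \<Rightarrow> 'u set) \<Rightarrow> ('s itype \<Rightarrow> 'v::real_vector set) \<Rightarrow> ('s itype \<Rightarrow> 'u \<Rightarrow> 'v) \<Rightarrow>
     's itype \<Rightarrow> 's itype \<Rightarrow> ('u \<Rightarrow> 'u) \<Rightarrow> ('v \<Rightarrow> 'v) \<Rightarrow> bool" where
  "is_lift1 D V h \<alpha> \<beta> g g' \<longleftrightarrow>
     is_lift D V h 1 (\<lambda>i. if i = 1 then \<alpha> else \<beta>) (\<lambda>a. g (a 1)) (\<lambda>x. g' (x 1))"

text \<open>\<open>comp_upto f n\<close> is \<open>f n \<circ> \<dots> \<circ> f 1\<close>.\<close>

primrec comp_upto :: "(nat \<Rightarrow> 'a \<Rightarrow> 'a) \<Rightarrow> nat \<Rightarrow> 'a \<Rightarrow> 'a" where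
  "comp_upto f 0 = id"
| "comp_upto f (Suc n) = f (Suc n) \<circ> comp_upto f n"

end

theory Submission
  imports Defs
begin

text \<open>
  Take for the space of type \<open>\<tau>\<close> the free vector space on the set \<open>D \<tau>\<close>, that is, the finitely
  supported real functions with support in \<open>D \<tau>\<close>, and for \<open>h \<tau>\<close> the inclusion of the basis.
  By the universal property of the tensor product of free vector spaces, \<^emph>\<open>every\<close> function of
  \<open>n\<close> arguments between the bases extends to a multilinear map,
  which expands each argument in the basis and distributes:
  \<open>F(x\<^sub>1, \<dots>, x\<^sub>n) = \<Sum> x\<^sub>1(d\<^sub>1) \<dots> x\<^sub>n(d\<^sub>n) f(d\<^sub>1, \<dots>, d\<^sub>n)\<close>, the sum ranging over the tuples of support
  points. On basis vectors only one term survives, so this extension is a lift of \<open>f\<close>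
  (\<open>multilinear_extension_basis\<close>).

  Its multilinearity would be plain distributivity, were it not that the range of summation depends
  on the arguments and that supports may shrink under addition. Both sides of the identities are
  therefore first rewritten as sums over one common finite box (\<open>multilinear_extension_superset\<close>).

  Functoriality is forced by the lifting equation alone: it determines the value of a lift of a
  unary function at every point of the image of \<open>h\<close>, so \<open>h\<close> can be pushed through a composition one
  factor at a time.
\<close>

section \<open>Multilinear maps out of free vector spaces\<close>

definition basis_vector :: "'a \<Rightarrow> ('a, real) poly_mapping" where
  "basis_vector a = Poly_Mapping.single a 1"

lemma lookup_scaleR: "Poly_Mapping.lookup (c *\<^sub>R x) a = c *\<^sub>R Poly_Mapping.lookup x a"
  by (simp add: scaleR_poly_mapping_def)

lemma inj_basis_vector: "inj basis_vector"
  unfolding basis_vector_def by (rule injI) (metis lookup_single_eq lookup_single_not_eq zero_neq_one)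

text \<open>
  The support condition is closed under linear combinations; this is what keeps the arguments of
  \<open>f\<close> in its domain when the extension is evaluated on a span.
\<close>

lemma keys_subset_if_in_span_basis:
  assumes "x \<in> span (basis_vector ` A)"
  shows "Poly_Mapping.keys x \<subseteq> A"
  using assms
proof (induction rule: span_induct_alt)
  case base
  show ?case by simp
next
  case (step c y z)
  have "Poly_Mapping.keys (c *\<^sub>R y) \<subseteq> A"
    using step(1) by (force simp: basis_vector_def in_keys_iff lookup_scaleR lookup_single when_def split: if_splits)
  then show ?case
    using step(2) Poly_Mapping.keys_add[of "c *\<^sub>R y" z] by blast
qed

definition multilinear_extension ::
    "'i set \<Rightarrow> (('i \<Rightarrow> 'a) \<Rightarrow> 'b) \<Rightarrow> ('i \<Rightarrow> ('a, real) poly_mapping) \<Rightarrow> ('b, real) poly_mapping" where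
  "multilinear_extension N f x =
     (\<Sum>d \<in> (\<Pi>\<^sub>E i\<in>N. Poly_Mapping.keys (x i)).
        (\<Prod>i\<in>N. Poly_Mapping.lookup (x i) (d i)) *\<^sub>R basis_vector (f d))"

text \<open>A tuple outside the product of the supports has a vanishing coefficient.\<close>

lemma multilinear_extension_superset:
  assumes "finite N" and "\<And>i. i \<in> N \<Longrightarrow> finite (K i)"
    and "\<And>i. i \<in> N \<Longrightarrow> Poly_Mapping.keys (x i) \<subseteq> K i"
  shows "multilinear_extension N f x =
    (\<Sum>d \<in> (\<Pi>\<^sub>E i\<in>N. K i). (\<Prod>i\<in>N. Poly_Mapping.lookup (x i) (d i)) *\<^sub>R basis_vector (f d))"
  unfolding multilinear_extension_def
proof (rule sum.mono_neutral_left)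
  show "finite (\<Pi>\<^sub>E i\<in>N. K i)"
    using assms(1,2) by (rule finite_PiE)
  show "(\<Pi>\<^sub>E i\<in>N. Poly_Mapping.keys (x i)) \<subseteq> (\<Pi>\<^sub>E i\<in>N. K i)"
    using assms(3) by (rule PiE_mono)
  show "\<forall>d \<in> (\<Pi>\<^sub>E i\<in>N. K i) - (\<Pi>\<^sub>E i\<in>N. Poly_Mapping.keys (x i)).
    (\<Prod>i\<in>N. Poly_Mapping.lookup (x i) (d i)) *\<^sub>R basis_vector (f d) = 0"
  proof
    fix d assume "d \<in> (\<Pi>\<^sub>E i\<in>N. K i) - (\<Pi>\<^sub>E i\<in>N. Poly_Mapping.keys (x i))"
    then obtain i where "i \<in> N" "d i \<notin> Poly_Mapping.keys (x i)"
      by (auto simp: PiE_iff)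
    then have "(\<Prod>i\<in>N. Poly_Mapping.lookup (x i) (d i)) = 0"
      using assms(1) by (auto simp: in_keys_iff lookup_scaleR)
    then show "(\<Prod>i\<in>N. Poly_Mapping.lookup (x i) (d i)) *\<^sub>R basis_vector (f d) = 0"
      by simp
  qed
qed

text \<open>
  With the support of one argument replaced by a larger finite set and its factor isolated, the
  extension is visibly linear in that argument: everything else is independent of \<open>u\<close>.
\<close>

lemma multilinear_extension_fun_upd:
  assumes "finite N" "i \<in> N" "finite A" "Poly_Mapping.keys u \<subseteq> A"
  shows "multilinear_extension N f (x(i := u)) =
    (\<Sum>d \<in> (\<Pi>\<^sub>E j\<in>N. if j = i then A else Poly_Mapping.keys (x j)).
       (Poly_Mapping.lookup u (d i) * (\<Prod>j\<in>N - {i}. Poly_Mapping.lookup (x j) (d j)))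
         *\<^sub>R basis_vector (f d))"
proof -
  have "(\<Prod>j\<in>N. Poly_Mapping.lookup ((x(i := u)) j) (d j)) =
      Poly_Mapping.lookup u (d i) * (\<Prod>j\<in>N - {i}. Poly_Mapping.lookup (x j) (d j))" for d
    using assms(1,2) by (simp add: prod.remove)
  then show ?thesis
    using assms
    by (subst multilinear_extension_superset
          [where K = "\<lambda>j. if j = i then A else Poly_Mapping.keys (x j)"]) auto
qed

lemma multilinear_extension_add:
  assumes "finite N" "i \<in> N"
  shows "multilinear_extension N f (x(i := u + v)) =
    multilinear_extension N f (x(i := u)) + multilinear_extension N f (x(i := v))"
proof -
  let ?A = "Poly_Mapping.keys u \<union> Poly_Mapping.keys v"
  note expand = multilinear_extension_fun_upd[OF assms, of ?A _ f x]
  show ?thesis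
    using Poly_Mapping.keys_add[of u v]
    by (simp add: expand lookup_add distrib_right scaleR_add_left sum.distrib)
qed

lemma multilinear_extension_scaleR:
  assumes "finite N" "i \<in> N"
  shows "multilinear_extension N f (x(i := c *\<^sub>R u)) = c *\<^sub>R multilinear_extension N f (x(i := u))"
proof -
  have "Poly_Mapping.keys (c *\<^sub>R u) \<subseteq> Poly_Mapping.keys u"
    by (auto simp: in_keys_iff lookup_scaleR)
  then show ?thesis
    by (simp add: multilinear_extension_fun_upd[OF assms, of "Poly_Mapping.keys u" _ f x]
        lookup_scaleR scaleR_sum_right mult.assoc)
qed

lemma multilinear_extension_basis:
  assumes "a \<in> extensional N"
  shows "multilinear_extension N f (\<lambda>i\<in>N. basis_vector (a i)) = basis_vector (f a)"
proof -
  have "(\<Pi>\<^sub>E i\<in>N. Poly_Mapping.keys ((\<lambda>i\<in>N. basis_vector (a i)) i)) = (\<Pi>\<^sub>E i\<in>N. {a i})"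
    by (rule PiE_cong) (simp add: basis_vector_def)
  also have "\<dots> = {a}"
    using assms by (rule PiE_singleton)
  finally show ?thesis
    by (simp add: multilinear_extension_def basis_vector_def)
qed

lemma multilinear_extension_in_span:
  assumes "\<And>i. i \<in> N \<Longrightarrow> x i \<in> span (basis_vector ` A i)"
    and "f \<in> (\<Pi>\<^sub>E i\<in>N. A i) \<rightarrow> B"
  shows "multilinear_extension N f x \<in> span (basis_vector ` B)"
  unfolding multilinear_extension_def
proof (intro span_sum span_scale span_base imageI)
  fix d assume "d \<in> (\<Pi>\<^sub>E i\<in>N. Poly_Mapping.keys (x i))"
  moreover have "(\<Pi>\<^sub>E i\<in>N. Poly_Mapping.keys (x i)) \<subseteq> (\<Pi>\<^sub>E i\<in>N. A i)"
    by (intro PiE_mono keys_subset_if_in_span_basis assms(1))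
  ultimately show "f d \<in> B"
    using assms(2) by blast
qed

lemma multilinear_on_multilinear_extension:
  assumes "f \<in> (\<Pi>\<^sub>E i\<in>{1..n}. A i) \<rightarrow> B"
  shows "multilinear_on n (\<lambda>i. span (basis_vector ` A i)) (span (basis_vector ` B))
    (multilinear_extension {1..n} f)"
  unfolding multilinear_on_def
proof (intro conjI ballI allI funcsetI)
  fix x assume "x \<in> (\<Pi>\<^sub>E i\<in>{1..n}. span (basis_vector ` A i))"
  then show "multilinear_extension {1..n} f x \<in> span (basis_vector ` B)"
    by (intro multilinear_extension_in_span[OF _ assms]) (auto simp: PiE_iff)
qed (simp_all only: multilinear_extension_add multilinear_extension_scaleR finite_atLeastAtMost)

section \<open>Lifts of semantic functions\<close>

lemma is_lift_multilinear_extension: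
  assumes "semantic_function D n \<tau> f"
  shows "is_lift D (\<lambda>\<tau>. span (basis_vector ` D \<tau>)) (\<lambda>_. basis_vector) n \<tau> f
    (multilinear_extension {1..n} f)"
proof -
  let ?F = "multilinear_extension {1..n} f"
  have f: "f \<in> (\<Pi>\<^sub>E i\<in>{1..n}. D (\<tau> i)) \<rightarrow> D (\<tau> (n + 1))"
    using assms by (simp add: semantic_function_def)
  have lift: "?F (\<lambda>i\<in>{1..n}. basis_vector (a i)) = basis_vector (f a)"
    if "a \<in> (\<Pi>\<^sub>E i\<in>{1..n}. D (\<tau> i))" for a
    using that by (intro multilinear_extension_basis) (simp add: PiE_def)
  have "?F x \<in> basis_vector ` D (\<tau> (n + 1))"
    if x: "x \<in> (\<Pi>\<^sub>E i\<in>{1..n}. basis_vector ` D (\<tau> i))" for x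
  proof -
    have "\<forall>i\<in>{1..n}. \<exists>b. b \<in> D (\<tau> i) \<and> x i = basis_vector b"
      using x by (auto simp: PiE_iff)
    then obtain b where b: "\<forall>i\<in>{1..n}. b i \<in> D (\<tau> i) \<and> x i = basis_vector (b i)"
      by metis
    let ?a = "restrict b {1..n}"
    have a: "?a \<in> (\<Pi>\<^sub>E i\<in>{1..n}. D (\<tau> i))"
      using b by auto
    have "x = (\<lambda>i\<in>{1..n}. basis_vector (?a i))"
      using x b by (intro extensionalityI[of _ "{1..n}"]) (auto simp: PiE_iff)
    then have "?F x = basis_vector (f ?a)"
      using lift[OF a] by simp
    then show ?thesis
      using f a by blast
  qed
  then show ?thesis
    using multilinear_on_multilinear_extension[OF f] lift
    by (auto simp: is_lift_def)
qed

lemma is_lift1_apply: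
  assumes "is_lift1 D V h \<alpha> \<beta> g g'" and "a \<in> D \<alpha>"
  shows "g' (h \<alpha> a) = h \<beta> (g a)"
proof -
  let ?a = "\<lambda>i\<in>{1..1::nat}. a"
  let ?\<tau> = "\<lambda>i::nat. if i = 1 then \<alpha> else \<beta>"
  have "?a \<in> (\<Pi>\<^sub>E i\<in>{1..1}. D (?\<tau> i))"
    using assms(2) by auto
  then have "h (?\<tau> (1 + 1)) (g (?a 1)) = g' ((\<lambda>i\<in>{1..1}. h (?\<tau> i) (?a i)) 1)"
    using assms(1) unfolding is_lift1_def is_lift_def by blast
  then show ?thesis by simp
qed

text \<open>
  Besides the lifting equation the induction carries along that the intermediate values stay in the
  domains, since lifts are determined only there.
\<close>

lemma comp_upto_lift:
  assumes "\<forall>i\<in>{1..n}. f i \<in> D (\<tau> i) \<rightarrow> D (\<tau> (i + 1)) \<and>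
      is_lift1 D V h (\<tau> i) (\<tau> (i + 1)) (f i) (f' i)"
    and "a \<in> D (\<tau> 1)"
  shows "comp_upto f n a \<in> D (\<tau> (n + 1)) \<and>
    comp_upto f' n (h (\<tau> 1) a) = h (\<tau> (n + 1)) (comp_upto f n a)"
  using assms(1)
proof (induction n)
  case 0
  show ?case using assms(2) by simp
next
  case (Suc n)
  then have IH: "comp_upto f n a \<in> D (\<tau> (Suc n))"
      "comp_upto f' n (h (\<tau> 1) a) = h (\<tau> (Suc n)) (comp_upto f n a)"
    by auto
  have "f (Suc n) \<in> D (\<tau> (Suc n)) \<rightarrow> D (\<tau> (Suc n + 1))"
    and "is_lift1 D V h (\<tau> (Suc n)) (\<tau> (Suc n + 1)) (f (Suc n)) (f' (Suc n))"
    using Suc.prems by auto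
  then show ?case
    using IH is_lift1_apply[of D V h] by (auto simp: Pi_iff)
qed

theorem theorem6p1:
  fixes D :: "'s itype \<Rightarrow> 'u set"
    and tv :: "bool \<Rightarrow> 'u"
    and ap :: "'s itype \<Rightarrow> 's itype \<Rightarrow> 'u \<Rightarrow> 'u \<Rightarrow> 'u"
    and R :: "'s \<Rightarrow> ('u \<times> 'u) set"
    and S :: "('s \<Rightarrow> 'u) set"
    and ty :: "'c \<Rightarrow> 's itype"
    and I :: "'c \<Rightarrow> ('s \<Rightarrow> 'u) \<Rightarrow> 'u"
  assumes "intensional_model D tv ap R S ty I"
  shows "\<exists>(V :: 's itype \<Rightarrow> ('u, real) poly_mapping set)
     (h :: 's itype \<Rightarrow> 'u \<Rightarrow> ('u, real) poly_mapping).
    (\<forall>\<tau>. subspace (V \<tau>)) \<and>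
    (\<forall>\<tau>. h \<tau> \<in> D \<tau> \<rightarrow> V \<tau> \<and> inj_on (h \<tau>) (D \<tau>)) \<and>
    (\<forall>n\<ge>1. \<forall>\<tau> f. semantic_function D n \<tau> f \<longrightarrow> (\<exists>f'. is_lift D V h n \<tau> f f')) \<and>
    (\<forall>n\<ge>1. \<forall>(\<tau> :: nat \<Rightarrow> 's itype) f f' g'.
       (\<forall>i\<in>{1..n}. f i \<in> D (\<tau> i) \<rightarrow> D (\<tau> (i + 1)) \<and>
                   is_lift1 D V h (\<tau> i) (\<tau> (i + 1)) (f i) (f' i)) \<and>
       is_lift1 D V h (\<tau> 1) (\<tau> (n + 1)) (comp_upto f n) g' \<longrightarrow>
       (\<forall>v\<in>h (\<tau> 1) ` D (\<tau> 1). g' v = comp_upto f' n v))"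
proof -
  let ?V = "\<lambda>\<tau>. span (basis_vector ` D \<tau>)"
  let ?h = "\<lambda>_ :: 's itype. basis_vector :: 'u \<Rightarrow> ('u, real) poly_mapping"
  have "g' v = comp_upto f' n v"
    if lifts: "\<forall>i\<in>{1..n}. f i \<in> D (\<tau> i) \<rightarrow> D (\<tau> (i + 1)) \<and>
        is_lift1 D ?V ?h (\<tau> i) (\<tau> (i + 1)) (f i) (f' i)"
      and g': "is_lift1 D ?V ?h (\<tau> 1) (\<tau> (n + 1)) (comp_upto f n) g'"
      and v: "v \<in> ?h (\<tau> 1) ` D (\<tau> 1)"
    for n and \<tau> :: "nat \<Rightarrow> 's itype" and f f' g' v
  proof -
    obtain a where a: "a \<in> D (\<tau> 1)" "v = basis_vector a"
      using v by blast
    show ?thesis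
      using is_lift1_apply[OF g' a(1)] comp_upto_lift[OF lifts a(1)] a(2) by simp
  qed
  moreover have "basis_vector \<in> D \<tau> \<rightarrow> ?V \<tau>" for \<tau>
    by (auto intro: span_base)
  moreover have "inj_on basis_vector (D \<tau>)" for \<tau>
    using inj_basis_vector by (rule inj_on_subset) simp
  ultimately show ?thesis
    using is_lift_multilinear_extension[of D]
    by (intro exI[of _ ?V] exI[of _ ?h]) (blast intro: subspace_span)
qed

end
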